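(* Consider the metric estimation problem described in the context and assume that each state space $A_n$ is finite. Let $\mathrm{Neg}_n\subseteq A_n$ be a (possibly observation-dependent) subset such that $\mathbb P_{post}(\mathrm{Neg}_n)\to0$ in probability. Suppose that for each $r<1$ there exist (possibly random) quantities $\varepsilon_n(r)>0$ and $K_n(r)>0$ with $K_n(r)\varepsilon_n(r)\to0$ in probability as $n\to\infty$, such that for any ball $B=B(x_0,r)\subseteq A_n$ of radius $r$ there exists a random function $F:B\setminus\mathrm{Neg}_n\to\mathcal P(A_n)$ (depending on $n$ and $B$) satisfying: (i) for every $x\in B\setminus\mathrm{Neg}_n$, $\mathbb P_{post}(\{x\})\le\varepsilon_n(r)\,\mathbb P_{post}(F(x))$; (ii) for every $y\in A_n$ there are at most $K_n(r)$ values of $x\in B\setminus\mathrm{Neg}_n$ such that $y\in F(x)$. Then partial estimation is intractable: for every $0\le r<1$ and every sequence of estimators $\hat X_n$, $\mathbb P(d(\hat X_n,X_n)>r)\to1$ as $n\to\infty$.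
   Context: Metric estimation problem: for each $n$, $(A_n,d=d_n,\mu=\mu_n)$ is a metric space of diameter $1$ equipped with a (prior) probability distribution; $B_n$ is a measurable observation space equipped with probability distributions $(\nu_x)_{x\in A_n}$ such that $x\mapsto\nu_x$ is measurable. $X_n\in A_n$ has law $\mu_n$ and, given $X_n$, $Y_n\in B_n$ has law $\nu_{X_n}$. For $S\subseteq A_n$, $\mathbb P_{post}(S)=\mathbb P(X_n\in S\mid Y_n)$. $B(x,r)$ is the closed ball of radius $r$ centred at $x$, and $\mathcal P(A_n)$ is the set of subsets of $A_n$. An estimator is a $Y_n$-measurable random variable with values in $A_n$. *)

theory Defs
  imports "HOL-Probability.Probability"
begin

definition metric_borel :: "'a metric \<Rightarrow> 'a measure" where
  "metric_borel A = sigma (mspace A) {U. openin (mtopology_of A) U}"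

text \<open>The boundedness conjunct is needed because the supremum of an unbounded
  set of reals is an unspecified value.\<close>
definition has_diameter :: "'a metric \<Rightarrow> real \<Rightarrow> bool" where
  "has_diameter A \<delta> \<longleftrightarrow>
     mspace A \<noteq> {} \<and>
     bdd_above {mdist A x y | x y. x \<in> mspace A \<and> y \<in> mspace A} \<and>
     Sup {mdist A x y | x y. x \<in> mspace A \<and> y \<in> mspace A} = \<delta>"

text \<open>Conditional probability of the event \<open>E\<close> given the sub-\<open>\<sigma>\<close>-algebra \<open>F\<close>. As with
  \<^const>\<open>real_cond_exp\<close>, this is one version, determined only almost everywhere.\<close>
definition cond_probability :: "'w measure \<Rightarrow> 'w measure \<Rightarrow> 'w set \<Rightarrow> 'w \<Rightarrow> real" where
  "cond_probability M F E = real_cond_exp M F (indicator E)"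

text \<open>The \<open>\<sigma>\<close>-algebra on the sample space generated by \<open>Y\<close>.\<close>
abbreviation generated_algebra :: "'w measure \<Rightarrow> ('w \<Rightarrow> 'b) \<Rightarrow> 'b measure \<Rightarrow> 'w measure" where
  "generated_algebra M Y B \<equiv> vimage_algebra (space M) Y B"

text \<open>One instance of the problem: state space \<open>A\<close> with prior \<open>\<mu>\<close>, observation space \<open>B\<close>
  (only its \<open>\<sigma>\<close>-algebra matters), kernel \<open>\<nu>\<close>, and the pair \<open>(X, Y)\<close> realised on an arbitrary
  probability space \<open>M\<close>, which may carry additional randomness.\<close>
locale metric_estimation = prob_space M
  for A :: "'a metric" and \<mu> :: "'a measure" and B :: "'b measure"
    and \<nu> :: "'a \<Rightarrow> 'b measure" and M :: "'w measure"
    and X :: "'w \<Rightarrow> 'a" and Y :: "'w \<Rightarrow> 'b" +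
  assumes diameter_one: "has_diameter A 1"
    and prior: "prob_space \<mu>" "sets \<mu> = sets (metric_borel A)"
    and kernel: "\<nu> \<in> metric_borel A \<rightarrow>\<^sub>M prob_algebra B"
    and state: "X \<in> M \<rightarrow>\<^sub>M metric_borel A" "distr M (metric_borel A) X = \<mu>"
    and observation: "Y \<in> M \<rightarrow>\<^sub>M B"
      "\<And>T. T \<in> sets B \<Longrightarrow>
        AE \<omega> in M. cond_probability M (generated_algebra M X (metric_borel A))
          {\<omega> \<in> space M. Y \<omega> \<in> T} \<omega> = measure (\<nu> (X \<omega>)) T"

text \<open>At a random set \<open>R\<close> the posterior is meant as the random posterior distribution evaluated
  at the realised set, i.e. \<open>posterior B M X Y (R \<omega>) \<omega>\<close>. If \<open>R\<close> is \<open>Y\<close>-measurable with values in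
  the subsets of a finite set, this is a version of the conditional probability of \<open>X \<in> R\<close>
  given \<open>Y\<close>.\<close>
definition posterior ::
  "'b measure \<Rightarrow> 'w measure \<Rightarrow> ('w \<Rightarrow> 'a) \<Rightarrow> ('w \<Rightarrow> 'b) \<Rightarrow> 'a set \<Rightarrow> 'w \<Rightarrow> real" where
  "posterior B M X Y S =
     cond_probability M (generated_algebra M Y B) {\<omega> \<in> space M. X \<omega> \<in> S}"

definition estimator ::
  "'a metric \<Rightarrow> 'b measure \<Rightarrow> 'w measure \<Rightarrow> ('w \<Rightarrow> 'b) \<Rightarrow> ('w \<Rightarrow> 'a) \<Rightarrow> bool" where
  "estimator A B M Y Xhat \<longleftrightarrow> Xhat \<in> generated_algebra M Y B \<rightarrow>\<^sub>M metric_borel A"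

text \<open>A random subset of a finite set \<open>S\<close>, measurable with respect to \<open>F\<close>.\<close>
definition random_subset :: "'w measure \<Rightarrow> 'a set \<Rightarrow> ('w \<Rightarrow> 'a set) \<Rightarrow> bool" where
  "random_subset F S R \<longleftrightarrow> R \<in> F \<rightarrow>\<^sub>M count_space (Pow S)"

text \<open>Convergence in probability to a constant, where the \<open>n\<close>-th variable may live on its
  own probability space.\<close>
definition tendsto_in_prob ::
  "(nat \<Rightarrow> 'w measure) \<Rightarrow> (nat \<Rightarrow> 'w \<Rightarrow> real) \<Rightarrow> real \<Rightarrow> bool" where
  "tendsto_in_prob M Z c \<longleftrightarrow>
     (\<forall>n. Z n \<in> borel_measurable (M n)) \<and>
     (\<forall>\<delta>>0. (\<lambda>n. \<P>(\<omega> in M n. \<bar>Z n \<omega> - c\<bar> > \<delta>)) \<longlonglongrightarrow> 0)"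

end

theory Submission
  imports Defs
begin

text \<open>Almost surely, summing (i) over the part of a ball outside \<open>Neg\<close> and exchanging the order
  of summation, (ii) bounds the posterior mass of that part by \<open>K \<cdot> \<epsilon>\<close>. Hence every ball of radius
  \<open>r\<close>, in particular the one around the estimator, has posterior mass at most
  \<open>K \<cdot> \<epsilon> + P\<^sub>p\<^sub>o\<^sub>s\<^sub>t(Neg)\<close>. This mass is also bounded by 1 and its expectation is the probability that
  the estimator is within \<open>r\<close> of the truth, which therefore tends to 0.\<close>

section \<open>Overlap counting for a finite weighted set\<close>

lemma sum_le_bounded_overlap:
  fixes p :: "'a \<Rightarrow> real"
  assumes "finite S" "finite C"
    and nonneg: "\<And>y. y \<in> S \<Longrightarrow> 0 \<le> p y" "0 \<le> e"
    and sub: "\<And>x. x \<in> C \<Longrightarrow> F x \<subseteq> S"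
    and le: "\<And>x. x \<in> C \<Longrightarrow> p x \<le> e * sum p (F x)"
    and overlap: "\<And>y. y \<in> S \<Longrightarrow> real (card {x \<in> C. y \<in> F x}) \<le> k"
  shows "sum p C \<le> k * e * sum p S"
proof -
  have "sum p C \<le> (\<Sum>x\<in>C. e * sum p (F x))"
    by (intro sum_mono le)
  \<comment> \<open>Since \<open>F x\<close> lies in \<open>S\<close>, it can be written as a
    filtered copy of \<open>S\<close>. Both ranges of the double sum are then fixed sets cut by the
    one relation \<open>y \<in> F x\<close>, the form in which the sums can be swapped.\<close>
  also have "\<dots> = e * (\<Sum>x\<in>C. \<Sum>y\<in>{y \<in> S. y \<in> F x}. p y)"
  proof -
    have "{y \<in> S. y \<in> F x} = F x" if "x \<in> C" for x
      using sub[OF that] by auto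
    then show ?thesis by (simp add: sum_distrib_left)
  qed
  also have "\<dots> = e * (\<Sum>y\<in>S. \<Sum>x\<in>{x \<in> C. y \<in> F x}. p y)"
    using assms(1,2) by (subst sum.swap_restrict) auto
  also have "\<dots> = e * (\<Sum>y\<in>S. real (card {x \<in> C. y \<in> F x}) * p y)"
    by simp
  also have "\<dots> \<le> e * (\<Sum>y\<in>S. k * p y)"
    by (intro mult_left_mono sum_mono mult_right_mono overlap nonneg)
  also have "\<dots> = k * e * sum p S"
    by (simp add: sum_distrib_left[symmetric])
  finally show ?thesis .
qed

section \<open>Borel structure of a finite metric space\<close>

lemma sets_metric_borel_finite:
  assumes "finite (mspace A)"
  shows "sets (metric_borel A) = Pow (mspace A)"
proof -
  have "openin (mtopology_of A) U" if "U \<subseteq> mspace A" for U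
  proof -
    \<comment> \<open>Finite subsets of a Hausdorff space are closed, in particular the complement
      of \<open>U\<close>. The topology is therefore discrete.\<close>
    have "Hausdorff_space (mtopology_of A)"
      unfolding mtopology_of_def
      by (simp add: Metric_space.Hausdorff_space_mtopology)
    moreover have "finite (mspace A - U)" using assms by simp
    ultimately have "closedin (mtopology_of A) (mspace A - U)"
      by (simp add: closedin_Hausdorff_finite)
    then show ?thesis
      using that by (simp add: openin_closedin_eq)
  qed
  then have "{U. openin (mtopology_of A) U} = Pow (mspace A)"
    using openin_subset by fastforce
  then show ?thesis
    by (simp add: metric_borel_def sigma_algebra.sigma_sets_eq[OF sigma_algebra_Pow])
qed

lemma space_metric_borel: "space (metric_borel A) = mspace A"
  unfolding metric_borel_def
  by (rule space_measure_of) (use openin_subset in fastforce)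

section \<open>The posterior as a random probability distribution\<close>

context metric_estimation
begin

lemma subalgebra_generated: "subalgebra M (generated_algebra M Y B)"
  using observation(1)
  by (auto simp: subalgebra_def sets_vimage_algebra2 measurable_space)

text \<open>Opens the calculus of conditional expectation given \<open>Y\<close>: finiteness of
  \<open>M\<close> passes to the sub-sigma-algebra and supplies the sigma-finiteness that
  \<open>real_cond_exp\<close> relies on.\<close>

sublocale observed: finite_measure_subalgebra M "generated_algebra M Y B"
  by unfold_locales (rule subalgebra_generated)

lemma state_space: "\<omega> \<in> space M \<Longrightarrow> X \<omega> \<in> mspace A"
  using measurable_space[OF state(1)] by (simp add: space_metric_borel)

context
  assumes finite_space: "finite (mspace A)"
begin

text \<open>Only the trace of \<open>S\<close> on the state space matters, and every subset of a
  finite state space is measurable, so \<open>S\<close> can be arbitrary.\<close>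

lemma state_events: "{\<omega> \<in> space M. X \<omega> \<in> S} \<in> sets M"
proof -
  have "{\<omega> \<in> space M. X \<omega> \<in> S} = X -` (S \<inter> mspace A) \<inter> space M"
    using state_space by auto
  then show ?thesis
    using measurable_sets[OF state(1), of "S \<inter> mspace A"]
    by (simp add: sets_metric_borel_finite[OF finite_space])
qed

lemma integrable_state_indicator:
  "integrable M (indicator {\<omega> \<in> space M. X \<omega> \<in> S} :: _ \<Rightarrow> real)"
  using state_events[of S] by (simp add: emeasure_eq_measure)

lemma AE_posterior_singleton_nonneg:
  "AE \<omega> in M. \<forall>x\<in>mspace A. 0 \<le> posterior B M X Y {x} \<omega>"
proof (subst AE_finite_all[OF finite_space], intro ballI)
  fix x
  show "AE \<omega> in M. 0 \<le> posterior B M X Y {x} \<omega>"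
    unfolding posterior_def cond_probability_def
    using state_events[of "{x}"]
    by (intro observed.real_cond_exp_pos) auto
qed

text \<open>For a fixed \<open>S\<close> this is linearity of conditional expectation, valid off a
  null set depending on \<open>S\<close>. There are finitely many \<open>S\<close>, so one null set
  serves them all; this is what later permits a set that depends on \<open>\<omega>\<close>.\<close>

lemma AE_sum_posterior_singleton:
  "AE \<omega> in M. \<forall>S\<in>Pow (mspace A).
     (\<Sum>x\<in>S. posterior B M X Y {x} \<omega>) = posterior B M X Y S \<omega>"
proof (subst AE_finite_all, use finite_space in simp, intro ballI)
  fix S assume "S \<in> Pow (mspace A)"
  then have fin: "finite S" using finite_space finite_subset by auto
  \<comment> \<open>At most one summand is nonzero, the one with
    \<open>x = X \<omega>\<close>.\<close>
  have eq: "(\<lambda>\<omega>. \<Sum>x\<in>S. indicator {\<omega> \<in> space M. X \<omega> \<in> {x}} \<omega>)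
      = (indicator {\<omega> \<in> space M. X \<omega> \<in> S} :: _ \<Rightarrow> real)"
    using fin by (auto simp: fun_eq_iff indicator_def of_bool_def sum.If_cases split: if_splits)
  have "AE \<omega> in M. posterior B M X Y S \<omega> = (\<Sum>x\<in>S. posterior B M X Y {x} \<omega>)"
    unfolding posterior_def cond_probability_def eq[symmetric]
    by (intro observed.real_cond_exp_sum integrable_state_indicator)
  then show "AE \<omega> in M. (\<Sum>x\<in>S. posterior B M X Y {x} \<omega>) = posterior B M X Y S \<omega>"
    by eventually_elim (rule sym)
qed

lemma AE_posterior_space: "AE \<omega> in M. posterior B M X Y (mspace A) \<omega> = 1"
proof -
  have eq: "{\<omega> \<in> space M. X \<omega> \<in> mspace A} = space M"
    using state_space by auto
  have "AE \<omega> in M. real_cond_exp M (generated_algebra M Y B) (\<lambda>_. 1) \<omega> = (1::real)"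
    by (intro observed.real_cond_exp_F_meas) auto
  \<comment> \<open>The indicator of \<open>space M\<close> and the constant 1 agree only on the
    sample space, so a congruence step links their conditional expectations.\<close>
  moreover have "AE \<omega> in M. real_cond_exp M (generated_algebra M Y B) (\<lambda>_. 1) \<omega>
      = real_cond_exp M (generated_algebra M Y B) (indicator (space M)) \<omega>"
    by (intro observed.real_cond_exp_cong) auto
  ultimately show ?thesis
    unfolding posterior_def cond_probability_def eq by eventually_elim simp
qed

text \<open>Off a single null set the chosen versions of the conditional probabilities form a
  genuine probability distribution on the states, so deterministic arguments can be run pointwise in
  \<open>\<omega>\<close>.\<close>

lemma AE_posterior_distribution:
  "AE \<omega> in M. (\<forall>x\<in>mspace A. 0 \<le> posterior B M X Y {x} \<omega>)
     \<and> (\<forall>S\<in>Pow (mspace A). (\<Sum>x\<in>S. posterior B M X Y {x} \<omega>) = posterior B M X Y S \<omega>)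
     \<and> (\<Sum>x\<in>mspace A. posterior B M X Y {x} \<omega>) = 1"
  using AE_posterior_singleton_nonneg AE_sum_posterior_singleton AE_posterior_space
  by eventually_elim auto

text \<open>The tower property for a \<open>Y\<close>-measurable set: each event
  \<open>x \<in> R \<omega>\<close> is known from \<open>Y\<close>, so conditioning replaces the
  indicator of \<open>X \<omega> = x\<close> on it by the posterior weight of \<open>x\<close>.
  Summing singleton weights makes the integrand a finite sum of integrable functions.\<close>

lemma
  assumes R: "random_subset (generated_algebra M Y B) (mspace A) R"
  shows integrable_posterior_random_subset:
      "integrable M (\<lambda>\<omega>. \<Sum>x\<in>R \<omega>. posterior B M X Y {x} \<omega>)" (is ?integrable)
    and prob_state_in_random_subset:
      "\<P>(\<omega> in M. X \<omega> \<in> R \<omega>) = expectation (\<lambda>\<omega>. \<Sum>x\<in>R \<omega>. posterior B M X Y {x} \<omega>)" (is ?prob)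
proof -
  let ?G = "generated_algebra M Y B"
  define E where "E x = {\<omega> \<in> space M. x \<in> R \<omega>}" for x
  have RS: "R \<omega> \<subseteq> mspace A" if "\<omega> \<in> space M" for \<omega>
    using measurable_space[OF R[unfolded random_subset_def], of \<omega>] that by simp
  have E: "E x \<in> sets ?G" for x
  proof -
    have "E x = R -` {T \<in> Pow (mspace A). x \<in> T} \<inter> space ?G"
      using RS by (auto simp: E_def)
    then show ?thesis
      using measurable_sets[OF R[unfolded random_subset_def], of "{T \<in> Pow (mspace A). x \<in> T}"]
      by auto
  qed
  then have EM: "E x \<in> sets M" for x
    using subalgebra_generated by (auto simp: subalgebra_def)
  \<comment> \<open>The random index set becomes the fixed set of states with indicator weights, so
    that sum and integral can be exchanged.\<close>
  have sum_eq: "(\<Sum>x\<in>R \<omega>. posterior B M X Y {x} \<omega>)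
      = (\<Sum>x\<in>mspace A. indicator (E x) \<omega> * posterior B M X Y {x} \<omega>)" if "\<omega> \<in> space M" for \<omega>
    using RS[OF that] that finite_space
    by (intro sum.mono_neutral_cong_left) (auto simp: E_def)
  have int: "integrable M (\<lambda>\<omega>. indicator (E x) \<omega> * posterior B M X Y {x} \<omega>)" for x
    using integrable_mult_indicator[OF EM
        observed.real_cond_exp_int(1)[OF integrable_state_indicator, of "{x}"]]
    by (simp add: posterior_def cond_probability_def)
  show ?integrable
    by (subst Bochner_Integration.integrable_cong[OF refl sum_eq]) (auto intro: int)
  \<comment> \<open>The event is split into disjoint pieces according to the value of
    \<open>X\<close>.\<close>
  have "\<P>(\<omega> in M. X \<omega> \<in> R \<omega>)
      = measure M (\<Union>x\<in>mspace A. E x \<inter> {\<omega> \<in> space M. X \<omega> \<in> {x}})"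
    using state_space by (intro arg_cong[where f = "measure M"]) (auto simp: E_def)
  also have "\<dots> = (\<Sum>x\<in>mspace A. measure M (E x \<inter> {\<omega> \<in> space M. X \<omega> \<in> {x}}))"
    using EM state_events[of "{x}" for x]
    by (intro finite_measure_finite_Union finite_space) (auto simp: disjoint_family_on_def)
  also have "\<dots> = (\<Sum>x\<in>mspace A. \<integral>\<omega>\<in>E x. indicator {\<omega> \<in> space M. X \<omega> \<in> {x}} \<omega> \<partial>M)"
  proof (intro sum.cong refl)
    fix x
    have "E x \<inter> {\<omega> \<in> space M. X \<omega> \<in> {x}} \<in> sets M"
      using EM state_events by blast
    then show "measure M (E x \<inter> {\<omega> \<in> space M. X \<omega> \<in> {x}})
        = (\<integral>\<omega>\<in>E x. indicator {\<omega> \<in> space M. X \<omega> \<in> {x}} \<omega> \<partial>M)"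
      unfolding set_lebesgue_integral_def real_scaleR_def indicator_inter_arith[symmetric]
      by (simp del: singleton_iff)
  qed
  \<comment> \<open>This is the defining property of conditional expectation, applied on the set
    \<open>E x\<close> of the sigma-algebra generated by \<open>Y\<close>.\<close>
  also have "\<dots> = (\<Sum>x\<in>mspace A. \<integral>\<omega>. indicator (E x) \<omega> * posterior B M X Y {x} \<omega> \<partial>M)"
    by (subst observed.real_cond_exp_intA[OF integrable_state_indicator E])
      (simp add: posterior_def cond_probability_def set_lebesgue_integral_def)
  also have "\<dots> = expectation (\<lambda>\<omega>. \<Sum>x\<in>mspace A. indicator (E x) \<omega> * posterior B M X Y {x} \<omega>)"
    by (intro Bochner_Integration.integral_sum[symmetric] int)
  also have "\<dots> = expectation (\<lambda>\<omega>. \<Sum>x\<in>R \<omega>. posterior B M X Y {x} \<omega>)"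
    by (intro Bochner_Integration.integral_cong refl sum_eq[symmetric])
  finally show ?prob .
qed

section \<open>Posterior mass of the ball around an estimator\<close>

lemma random_subset_ball_estimator:
  assumes "estimator A B M Y Xhat"
  shows "random_subset (generated_algebra M Y B) (mspace A) (\<lambda>\<omega>. mcball_of A (Xhat \<omega>) r)"
proof -
  have "(\<lambda>z. mcball_of A z r) \<in> metric_borel A \<rightarrow>\<^sub>M count_space (Pow (mspace A))"
    by (rule measurableI) (auto simp: space_metric_borel sets_metric_borel_finite[OF finite_space])
  then show ?thesis
    using assms unfolding random_subset_def estimator_def by (rule measurable_compose[rotated])
qed

text \<open>Quantitative form for a single problem. Outside two exceptional events the ball mass is
  at most \<open>2 * \<delta>\<close>, one \<open>\<delta>\<close> for the part outside
  \<open>Neg\<close> and one for the part inside; on the exceptional events it is at most 1.\<close>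

lemma prob_estimator_within_le:
  assumes Neg: "\<And>\<omega>. \<omega> \<in> space M \<Longrightarrow> Neg \<omega> \<subseteq> mspace A"
    and pos: "AE \<omega> in M. 0 < \<epsilon> \<omega> \<and> 0 < K \<omega>"
    and meas: "(\<lambda>\<omega>. K \<omega> * \<epsilon> \<omega>) \<in> borel_measurable M"
      "(\<lambda>\<omega>. posterior B M X Y (Neg \<omega>) \<omega>) \<in> borel_measurable M"
    and spread: "\<And>x\<^sub>0. x\<^sub>0 \<in> mspace A \<Longrightarrow> \<exists>F :: 'w \<Rightarrow> 'a \<Rightarrow> 'a set.
      (\<forall>x \<in> mcball_of A x\<^sub>0 r. random_subset M (mspace A) (\<lambda>\<omega>. F \<omega> x)) \<and>
      (AE \<omega> in M. \<forall>x \<in> mcball_of A x\<^sub>0 r - Neg \<omega>.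
         posterior B M X Y {x} \<omega> \<le> \<epsilon> \<omega> * posterior B M X Y (F \<omega> x) \<omega>) \<and>
      (AE \<omega> in M. \<forall>y \<in> mspace A.
         real (card {x \<in> mcball_of A x\<^sub>0 r - Neg \<omega>. y \<in> F \<omega> x}) \<le> K \<omega>)"
    and est: "estimator A B M Y Xhat"
    and "0 < \<delta>"
  shows "\<P>(\<omega> in M. mdist A (Xhat \<omega>) (X \<omega>) \<le> r)
    \<le> 2 * \<delta> + \<P>(\<omega> in M. \<bar>K \<omega> * \<epsilon> \<omega>\<bar> > \<delta>) + \<P>(\<omega> in M. \<bar>posterior B M X Y (Neg \<omega>) \<omega>\<bar> > \<delta>)"
proof -
  let ?p = "\<lambda>x \<omega>. posterior B M X Y {x} \<omega>"
  let ?N = "\<lambda>\<omega>. posterior B M X Y (Neg \<omega>) \<omega>"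
  let ?R = "\<lambda>\<omega>. mcball_of A (Xhat \<omega>) r"
  let ?U = "{\<omega> \<in> space M. \<bar>K \<omega> * \<epsilon> \<omega>\<bar> > \<delta>}"
  let ?V = "{\<omega> \<in> space M. \<bar>?N \<omega>\<bar> > \<delta>}"
  have fin: "finite (mcball_of A z r)" for z
    using finite_space by (rule finite_subset[rotated]) auto
  have Xhat: "Xhat \<omega> \<in> mspace A" if "\<omega> \<in> space M" for \<omega>
    using measurable_space[OF est[unfolded estimator_def], of \<omega>] that
    by (simp add: space_metric_borel)
  \<comment> \<open>The function \<open>F\<close> and its null sets depend on the centre. As there
    are finitely many centres, the bound holds almost surely for all of them at once and can then be
    used at the random centre \<open>Xhat \<omega>\<close>.\<close>
  have ball: "AE \<omega> in M. \<forall>x\<^sub>0\<in>mspace A. (\<Sum>x\<in>mcball_of A x\<^sub>0 r - Neg \<omega>. ?p x \<omega>) \<le> K \<omega> * \<epsilon> \<omega>"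
  proof (subst AE_finite_all[OF finite_space], intro ballI)
    fix x\<^sub>0 assume "x\<^sub>0 \<in> mspace A"
    from spread[OF this] obtain F where
      F: "\<forall>x \<in> mcball_of A x\<^sub>0 r. random_subset M (mspace A) (\<lambda>\<omega>. F \<omega> x)"
      and F1: "AE \<omega> in M. \<forall>x \<in> mcball_of A x\<^sub>0 r - Neg \<omega>.
         ?p x \<omega> \<le> \<epsilon> \<omega> * posterior B M X Y (F \<omega> x) \<omega>"
      and F2: "AE \<omega> in M. \<forall>y \<in> mspace A.
         real (card {x \<in> mcball_of A x\<^sub>0 r - Neg \<omega>. y \<in> F \<omega> x}) \<le> K \<omega>"
      by blast
    have FS: "F \<omega> x \<subseteq> mspace A" if "\<omega> \<in> space M" "x \<in> mcball_of A x\<^sub>0 r" for \<omega> x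
      using measurable_space[OF bspec[OF F that(2), unfolded random_subset_def] that(1)] by simp
    show "AE \<omega> in M. (\<Sum>x\<in>mcball_of A x\<^sub>0 r - Neg \<omega>. ?p x \<omega>) \<le> K \<omega> * \<epsilon> \<omega>"
      using F1 F2 pos AE_posterior_distribution AE_space
    proof eventually_elim
      case (elim \<omega>)
      have "(\<Sum>x\<in>mcball_of A x\<^sub>0 r - Neg \<omega>. ?p x \<omega>) \<le> K \<omega> * \<epsilon> \<omega> * (\<Sum>x\<in>mspace A. ?p x \<omega>)"
      proof (rule sum_le_bounded_overlap[where F = "F \<omega>"])
        fix x assume x: "x \<in> mcball_of A x\<^sub>0 r - Neg \<omega>"
        show "F \<omega> x \<subseteq> mspace A" using FS[OF elim(5)] x by blast
        \<comment> \<open>The set \<open>F \<omega> x\<close> is random, so additivity is taken from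
          the statement valid for all subsets simultaneously.\<close>
        then have "(\<Sum>x\<in>F \<omega> x. ?p x \<omega>) = posterior B M X Y (F \<omega> x) \<omega>"
          using elim by blast
        then show "?p x \<omega> \<le> \<epsilon> \<omega> * (\<Sum>x\<in>F \<omega> x. ?p x \<omega>)"
          using elim(1) x by simp
      qed (use elim(2-4) finite_space fin in auto)
      then show ?case using elim(4) by simp
    qed
  qed
  \<comment> \<open>On \<open>?U\<close> or \<open>?V\<close> an indicator alone pays for the
    trivial bound 1; elsewhere both contributions are at most \<open>\<delta>\<close>.\<close>
  have mass: "AE \<omega> in M. (\<Sum>x\<in>?R \<omega>. ?p x \<omega>) \<le> 2 * \<delta> + indicator ?U \<omega> + indicator ?V \<omega>"
    using ball AE_posterior_distribution AE_space
  proof eventually_elim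
    case (elim \<omega>)
    have sub: "?R \<omega> \<subseteq> mspace A" by auto
    have "(\<Sum>x\<in>?R \<omega>. ?p x \<omega>) \<le> (\<Sum>x\<in>mspace A. ?p x \<omega>)"
      using elim sub by (intro sum_mono2 finite_space) blast+
    then have one: "(\<Sum>x\<in>?R \<omega>. ?p x \<omega>) \<le> 1" using elim(2) by simp
    have Neg': "Neg \<omega> \<subseteq> mspace A" using Neg elim by simp
    have "(\<Sum>x\<in>?R \<omega>. ?p x \<omega>) = (\<Sum>x\<in>?R \<omega> - Neg \<omega>. ?p x \<omega>) + (\<Sum>x\<in>?R \<omega> \<inter> Neg \<omega>. ?p x \<omega>)"
      using sum.Int_Diff[OF fin, of "\<lambda>x. ?p x \<omega>"] by (simp add: add.commute)
    also have "\<dots> \<le> K \<omega> * \<epsilon> \<omega> + (\<Sum>x\<in>Neg \<omega>. ?p x \<omega>)"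
      using elim(1,2) Xhat[OF elim(3)] Neg' finite_subset[OF Neg' finite_space]
      by (intro add_mono sum_mono2) blast+
    also have "(\<Sum>x\<in>Neg \<omega>. ?p x \<omega>) = ?N \<omega>" using elim(2) Neg' by blast
    finally show ?case
      using one elim(3) \<open>0 < \<delta>\<close> by (auto simp: indicator_def)
  qed
  have UV: "?U \<in> sets M" "?V \<in> sets M" using meas by measurable
  have "\<P>(\<omega> in M. mdist A (Xhat \<omega>) (X \<omega>) \<le> r) = \<P>(\<omega> in M. X \<omega> \<in> ?R \<omega>)"
    using Xhat state_space by (intro arg_cong[where f = "measure M"]) auto
  also have "\<dots> = expectation (\<lambda>\<omega>. \<Sum>x\<in>?R \<omega>. ?p x \<omega>)"
    by (rule prob_state_in_random_subset[OF random_subset_ball_estimator[OF est]])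
  also have "\<dots> \<le> expectation (\<lambda>\<omega>. 2 * \<delta> + indicator ?U \<omega> + indicator ?V \<omega>)"
    using UV mass
    by (intro integral_mono_AE
        integrable_posterior_random_subset[OF random_subset_ball_estimator[OF est]])
      (auto simp: emeasure_eq_measure)
  also have "\<dots> = 2 * \<delta> + measure M ?U + measure M ?V"
    using UV by (simp add: emeasure_eq_measure prob_space)
  finally show ?thesis .
qed

text \<open>Taking complements requires the event to be measurable. Splitting by the value of
  \<open>X\<close> makes it a finite union of intersections of an event of \<open>Xhat\<close> with
  an event of \<open>X\<close>.\<close>

lemma prob_estimator_far:
  assumes "estimator A B M Y Xhat"
  shows "\<P>(\<omega> in M. mdist A (Xhat \<omega>) (X \<omega>) > r) = 1 - \<P>(\<omega> in M. mdist A (Xhat \<omega>) (X \<omega>) \<le> r)"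
proof -
  have Xhat: "Xhat \<in> M \<rightarrow>\<^sub>M metric_borel A"
    using assms unfolding estimator_def by (rule measurable_from_subalg[OF subalgebra_generated])
  have Xhat_space: "Xhat \<omega> \<in> mspace A" if "\<omega> \<in> space M" for \<omega>
    using measurable_space[OF Xhat that] by (simp add: space_metric_borel)
  have "{\<omega> \<in> space M. mdist A (Xhat \<omega>) (X \<omega>) \<le> r}
    = (\<Union>x\<in>mspace A. (Xhat -` {z \<in> mspace A. mdist A z x \<le> r} \<inter> space M)
        \<inter> {\<omega> \<in> space M. X \<omega> \<in> {x}})"
    using Xhat_space state_space by auto
  moreover have "\<dots> \<in> sets M"
    by (intro sets.finite_UN finite_space sets.Int state_events measurable_sets[OF Xhat])
      (auto simp: sets_metric_borel_finite[OF finite_space])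
  ultimately have "{\<omega> \<in> space M. mdist A (Xhat \<omega>) (X \<omega>) \<le> r} \<in> sets M"
    by simp
  from prob_neg[OF this] show ?thesis by (simp add: not_le)
qed

end

end

section \<open>Passage to the limit\<close>

theorem lemma2p1:
  fixes A :: "nat \<Rightarrow> 'a metric" and \<mu> :: "nat \<Rightarrow> 'a measure"
    and B :: "nat \<Rightarrow> 'b measure" and \<nu> :: "nat \<Rightarrow> 'a \<Rightarrow> 'b measure"
    and M :: "nat \<Rightarrow> 'w measure"
    and X :: "nat \<Rightarrow> 'w \<Rightarrow> 'a" and Y :: "nat \<Rightarrow> 'w \<Rightarrow> 'b"
    and Neg :: "nat \<Rightarrow> 'w \<Rightarrow> 'a set"
  assumes problem: "\<And>n. metric_estimation (A n) (\<mu> n) (B n) (\<nu> n) (M n) (X n) (Y n)"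
    and finite_states: "\<And>n. finite (mspace (A n))"
    and Neg_observation_dependent:
      "\<And>n. random_subset (generated_algebra (M n) (Y n) (B n)) (mspace (A n)) (Neg n)"
    and Neg_negligible:
      "tendsto_in_prob M (\<lambda>n \<omega>. posterior (B n) (M n) (X n) (Y n) (Neg n \<omega>) \<omega>) 0"
    and spreading:
      "\<And>r :: real. 0 \<le> r \<Longrightarrow> r < 1 \<Longrightarrow>
        \<exists>(\<epsilon> :: nat \<Rightarrow> 'w \<Rightarrow> real) (K :: nat \<Rightarrow> 'w \<Rightarrow> real).
          (\<forall>n. \<epsilon> n \<in> borel_measurable (M n) \<and> K n \<in> borel_measurable (M n) \<and>
               (AE \<omega> in M n. \<epsilon> n \<omega> > 0 \<and> K n \<omega> > 0)) \<and>
          tendsto_in_prob M (\<lambda>n \<omega>. K n \<omega> * \<epsilon> n \<omega>) 0 \<and>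
          (\<forall>n. \<forall>x\<^sub>0 \<in> mspace (A n).
             (\<exists>F :: 'w \<Rightarrow> 'a \<Rightarrow> 'a set.
                (\<forall>x \<in> mcball_of (A n) x\<^sub>0 r. random_subset (M n) (mspace (A n)) (\<lambda>\<omega>. F \<omega> x)) \<and>
                (AE \<omega> in M n. \<forall>x \<in> mcball_of (A n) x\<^sub>0 r - Neg n \<omega>.
                   posterior (B n) (M n) (X n) (Y n) {x} \<omega>
                     \<le> \<epsilon> n \<omega> * posterior (B n) (M n) (X n) (Y n) (F \<omega> x) \<omega>) \<and>
                (AE \<omega> in M n. \<forall>y \<in> mspace (A n).
                   real (card {x \<in> mcball_of (A n) x\<^sub>0 r - Neg n \<omega>. y \<in> F \<omega> x}) \<le> K n \<omega>)))"
  shows "\<forall>r :: real. 0 \<le> r \<and> r < 1 \<longrightarrow>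
    (\<forall>Xhat :: nat \<Rightarrow> 'w \<Rightarrow> 'a.
       (\<forall>n. estimator (A n) (B n) (M n) (Y n) (Xhat n)) \<longrightarrow>
       (\<lambda>n. \<P>(\<omega> in M n. mdist (A n) (Xhat n \<omega>) (X n \<omega>) > r)) \<longlonglongrightarrow> 1)"
proof (intro allI impI)
  fix r :: real and Xhat :: "nat \<Rightarrow> 'w \<Rightarrow> 'a"
  assume r: "0 \<le> r \<and> r < 1" and est: "\<forall>n. estimator (A n) (B n) (M n) (Y n) (Xhat n)"
  then have r01: "0 \<le> r" "r < 1" by auto
  obtain \<epsilon> K :: "nat \<Rightarrow> 'w \<Rightarrow> real" where
    pos: "\<forall>n. \<epsilon> n \<in> borel_measurable (M n) \<and> K n \<in> borel_measurable (M n) \<and>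
      (AE \<omega> in M n. \<epsilon> n \<omega> > 0 \<and> K n \<omega> > 0)"
    and lim: "tendsto_in_prob M (\<lambda>n \<omega>. K n \<omega> * \<epsilon> n \<omega>) 0"
    and spread: "\<forall>n. \<forall>x\<^sub>0 \<in> mspace (A n). \<exists>F :: 'w \<Rightarrow> 'a \<Rightarrow> 'a set.
      (\<forall>x \<in> mcball_of (A n) x\<^sub>0 r. random_subset (M n) (mspace (A n)) (\<lambda>\<omega>. F \<omega> x)) \<and>
      (AE \<omega> in M n. \<forall>x \<in> mcball_of (A n) x\<^sub>0 r - Neg n \<omega>.
         posterior (B n) (M n) (X n) (Y n) {x} \<omega>
           \<le> \<epsilon> n \<omega> * posterior (B n) (M n) (X n) (Y n) (F \<omega> x) \<omega>) \<and>
      (AE \<omega> in M n. \<forall>y \<in> mspace (A n).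
         real (card {x \<in> mcball_of (A n) x\<^sub>0 r - Neg n \<omega>. y \<in> F \<omega> x}) \<le> K n \<omega>)"
    using spreading[OF r01] by (elim exE conjE) (rule that)
  let ?near = "\<lambda>n. \<P>(\<omega> in M n. mdist (A n) (Xhat n \<omega>) (X n \<omega>) \<le> r)"
  let ?u = "\<lambda>\<delta> n. \<P>(\<omega> in M n. \<bar>K n \<omega> * \<epsilon> n \<omega>\<bar> > \<delta>)"
  let ?v = "\<lambda>\<delta> n. \<P>(\<omega> in M n. \<bar>posterior (B n) (M n) (X n) (Y n) (Neg n \<omega>) \<omega>\<bar> > \<delta>)"
  have Neg: "Neg n \<omega> \<subseteq> mspace (A n)" if "\<omega> \<in> space (M n)" for n \<omega>
    using measurable_space[OF Neg_observation_dependent[of n, unfolded random_subset_def], of \<omega>] that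
    by simp
  have bound: "?near n \<le> 2 * \<delta> + ?u \<delta> n + ?v \<delta> n" if "0 < \<delta>" for \<delta> n
    using lim Neg_negligible est pos
    by (intro metric_estimation.prob_estimator_within_le[OF problem finite_states Neg]
        spread[rule_format] that) (auto simp: tendsto_in_prob_def)
  have "?near \<longlonglongrightarrow> 0"
  proof (rule tendstoI)
    fix e :: real assume "0 < e"
    \<comment> \<open>The bound is \<open>2 * \<delta>\<close> plus two probabilities that are
      eventually strictly below \<open>\<delta>\<close>, hence strictly below
      \<open>4 * \<delta> = e\<close>.\<close>
    define \<delta> where "\<delta> = e / 4"
    have "0 < \<delta>" using \<open>0 < e\<close> by (simp add: \<delta>_def)
    have "?u \<delta> \<longlonglongrightarrow> 0" "?v \<delta> \<longlonglongrightarrow> 0"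
      using lim Neg_negligible \<open>0 < \<delta>\<close> by (auto simp: tendsto_in_prob_def)
    then have "\<forall>\<^sub>F n in sequentially. ?u \<delta> n < \<delta>" "\<forall>\<^sub>F n in sequentially. ?v \<delta> n < \<delta>"
      using \<open>0 < \<delta>\<close> by (auto dest: order_tendstoD(2))
    then show "\<forall>\<^sub>F n in sequentially. dist (?near n) 0 < e"
    proof eventually_elim
      case (elim n)
      then show ?case using bound[OF \<open>0 < \<delta>\<close>, of n] by (simp add: \<delta>_def)
    qed
  qed
  then have "(\<lambda>n. 1 - ?near n) \<longlonglongrightarrow> 1 - 0"
    by (intro tendsto_diff tendsto_const)
  then show "(\<lambda>n. \<P>(\<omega> in M n. mdist (A n) (Xhat n \<omega>) (X n \<omega>) > r)) \<longlonglongrightarrow> 1"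
    using metric_estimation.prob_estimator_far[OF problem finite_states] est by simp
qed

end
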